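(* Let $(A,\cdot,\delta)$ be a commutative and cocommutative associative D-bialgebra over $K$ with linear maps $f,g,F,G:A\to A$. Define $[x,y]_{(f,g)}:=x\cdot f(y)+g(x\cdot y)$ and $\Delta_{(F,G)}(x):=x_{[1]}\otimes F(x_{[2]})+G(x)_{[1]}\otimes G(x)_{[2]}$. Then $(A,[,]_{(f,g)},\Delta_{(F,G)})$ is a left Alia bialgebra if and only if for all $x,y\in A$ \begin{align*} &f(y)_{[1]}\otimes F(x\cdot f(y)_{[2]})-F(x\cdot f(y)_{[2]})\otimes f(y)_{[1]}+F(x_{[2]})\otimes g(x_{[1]}\cdot y)-g(x_{[1]}\cdot y)\otimes F(x_{[2]})\\ &+G(x)_{[2]}\otimes G(x)_{[1]}\cdot f(y)-G(x)_{[1]}\cdot f(y)\otimes G(x)_{[2]}+G(x)_{[2]}\otimes g(G(x)_{[1]}\cdot y)-g(G(x)_{[1]}\cdot y)\otimes G(x)_{[2]}\\ &+F(y\cdot f(x)_{[2]})\otimes f(x)_{[1]}-f(x)_{[1]}\otimes F(y\cdot f(x)_{[2]})-F(y_{[2]})\otimes g(y_{[1]}\cdot x)+g(y_{[1]}\cdot x)\otimes F(y_{[2]})\\ &-G(y)_{[2]}\otimes G(y)_{[1]}\cdot f(x)+G(y)_{[1]}\cdot f(x)\otimes G(y)_{[2]}-G(y)_{[2]}\otimes g(G(y)_{[1]}\cdot x)+g(G(y)_{[1]}\cdot x)\otimes G(y)_{[2]}=0. \end{align*}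
   Context: All vector spaces are over a field $K$ of characteristic zero. Sweedler notation without summation sign: $\delta(x)=x_{[1]}\otimes x_{[2]}$, $\Delta(x)=x_{(1)}\otimes x_{(2)}$; e.g. $f(y)_{[1]}\otimes f(y)_{[2]}=\delta(f(y))$. $\tau$ is the flip map on $A\otimes A$. No unit or counit is assumed. A commutative and cocommutative associative D-bialgebra is a triple $(A,\cdot,\delta)$ where $(A,\cdot)$ is a commutative associative algebra, $(A,\delta)$ is a cocommutative coassociative coalgebra and $\delta(a\cdot b)=a_{[1]}\cdot b\otimes a_{[2]}+b_{[1]}\otimes a\cdot b_{[2]}$ for all $a,b\in A$. A left Alia algebra is a vector space $A$ with bilinear $[,]$ satisfying $[[x,y],z]+[[y,z],x]+[[z,x],y]=[[y,x],z]+[[z,y],x]+[[x,z],y]$. A left Alia coalgebra is $(A,\Delta)$, $\Delta:A\to A\otimes A$ linear, with $$x_{(1)(2)}\otimes x_{(1)(1)}\otimes x_{(2)}+x_{(1)(1)}\otimes x_{(2)}\otimes x_{(1)(2)}+x_{(2)}\otimes x_{(1)(2)}\otimes x_{(1)(1)}=x_{(1)(1)}\otimes x_{(1)(2)}\otimes x_{(2)}+x_{(1)(2)}\otimes x_{(2)}\otimes x_{(1)(1)}+x_{(2)}\otimes x_{(1)(1)}\otimes x_{(1)(2)},$$ where $x_{(1)(1)}\otimes x_{(1)(2)}\otimes x_{(2)}=(\Delta\otimes\mathrm{id})\Delta(x)$. A left Alia bialgebra is a triple $(A,[,],\Delta)$ with $(A,[,])$ a left Alia algebra, $(A,\Delta)$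 a left Alia coalgebra and, for all $x,y\in A$, $$(\tau-\mathrm{id}^{\otimes 2})\big(\Delta([x,y]-[y,x])\big)=(\tau-\mathrm{id}^{\otimes 2})\big((\mathcal R(y)\otimes\mathrm{id})\Delta(x)-(\mathcal R(x)\otimes\mathrm{id})\Delta(y)\big),$$ where $\mathcal R(y)z=[z,y]$. *)

theory Defs
  imports Complex_Main "HOL-Library.Function_Algebras"
begin

section \<open>Multilinear maps\<close>

text \<open>A vector space over the field \<open>'k\<close> is a type \<open>'a\<close> of class \<open>ab_group_add\<close> together with
  a scalar multiplication \<open>s\<close> satisfying \<^term>\<open>vector_space s\<close>. The predicate
  \<^term>\<open>Vector_Spaces.linear s s'\<close> includes the statement that \<open>s\<close> and \<open>s'\<close> are vector spaces.\<close>

definition bilinear_map ::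
  "('k::field \<Rightarrow> 'a::ab_group_add \<Rightarrow> 'a) \<Rightarrow> ('k \<Rightarrow> 'w::ab_group_add \<Rightarrow> 'w) \<Rightarrow> ('a \<Rightarrow> 'a \<Rightarrow> 'w) \<Rightarrow> bool"
  where "bilinear_map s sW \<phi> \<longleftrightarrow>
    (\<forall>x. Vector_Spaces.linear s sW (\<lambda>y. \<phi> x y)) \<and>
    (\<forall>y. Vector_Spaces.linear s sW (\<lambda>x. \<phi> x y))"

definition trilinear_map ::
  "('k::field \<Rightarrow> 'a::ab_group_add \<Rightarrow> 'a) \<Rightarrow> ('k \<Rightarrow> 'w::ab_group_add \<Rightarrow> 'w) \<Rightarrow> ('a \<Rightarrow> 'a \<Rightarrow> 'a \<Rightarrow> 'w) \<Rightarrow> bool"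
  where "trilinear_map s sW \<phi> \<longleftrightarrow>
    (\<forall>x y. Vector_Spaces.linear s sW (\<lambda>z. \<phi> x y z)) \<and>
    (\<forall>x z. Vector_Spaces.linear s sW (\<lambda>y. \<phi> x y z)) \<and>
    (\<forall>y z. Vector_Spaces.linear s sW (\<lambda>x. \<phi> x y z))"


section \<open>Tensor powers\<close>

text \<open>\<open>A \<otimes> A\<close> is realised inside the space of functionals on bilinear forms: \<open>x \<otimes> y\<close> is evaluation
  at \<open>(x, y)\<close> (and 0 on functions that are not bilinear, so that the ambient space can be a full
  function type), and \<open>A \<otimes> A\<close> is the span of these pure tensors. Likewise for \<open>A \<otimes> A \<otimes> A\<close>.
  The universal properties are proved below, so no dimension restriction is hidden here.
  Addition, subtraction and zero of tensors are the pointwise ones.\<close>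

type_synonym ('a, 'k) tensor2 = "('a \<Rightarrow> 'a \<Rightarrow> 'k) \<Rightarrow> 'k"
type_synonym ('a, 'k) tensor3 = "('a \<Rightarrow> 'a \<Rightarrow> 'a \<Rightarrow> 'k) \<Rightarrow> 'k"

definition tensor_scale :: "'k::field \<Rightarrow> ('b \<Rightarrow> 'k) \<Rightarrow> ('b \<Rightarrow> 'k)"
  where "tensor_scale c t = (\<lambda>B. c * t B)"

definition tensor :: "('k::field \<Rightarrow> 'a::ab_group_add \<Rightarrow> 'a) \<Rightarrow> 'a \<Rightarrow> 'a \<Rightarrow> ('a, 'k) tensor2"
    (infixl "\<otimes>\<index>" 70)
  where "x \<otimes>\<^bsub>s\<^esub> y = (\<lambda>B. if bilinear_map s (*) B then B x y else 0)"

definition tensor3 :: "('k::field \<Rightarrow> 'a::ab_group_add \<Rightarrow> 'a) \<Rightarrow> 'a \<Rightarrow> 'a \<Rightarrow> 'a \<Rightarrow> ('a, 'k) tensor3"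
  where "tensor3 s x y z = (\<lambda>B. if trilinear_map s (*) B then B x y z else 0)"

definition tensor_square :: "('k::field \<Rightarrow> 'a::ab_group_add \<Rightarrow> 'a) \<Rightarrow> ('a, 'k) tensor2 set"
  where "tensor_square s = module.span tensor_scale {x \<otimes>\<^bsub>s\<^esub> y | x y. True}"

text \<open>Sweedler notation: for \<open>t = t\<^sub>1 \<otimes> t\<^sub>2\<close> (implicit finite sum), \<open>sweedler s t \<phi>\<close> is
  \<open>\<phi> t\<^sub>1 t\<^sub>2\<close> (implicit sum), i.e. the value at \<open>t\<close> of the linear map on \<open>A \<otimes> A\<close> induced by the
  bilinear map \<open>\<phi>\<close>. Scalars are absorbed into the tensor factors.\<close>

definition sweedler ::
  "('k::field \<Rightarrow> 'a::ab_group_add \<Rightarrow> 'a) \<Rightarrow> ('a, 'k) tensor2 \<Rightarrow> ('a \<Rightarrow> 'a \<Rightarrow> 'w::ab_group_add) \<Rightarrow> 'w"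
  where "sweedler s t \<phi> =
    (THE w. \<exists>xs. t = (\<Sum>(a, b)\<leftarrow>xs. a \<otimes>\<^bsub>s\<^esub> b) \<and> w = (\<Sum>(a, b)\<leftarrow>xs. \<phi> a b))"

subsection \<open>Universal properties\<close>

lemma vector_space_tensor_scale: "vector_space (tensor_scale :: 'k::field \<Rightarrow> ('b \<Rightarrow> 'k) \<Rightarrow> ('b \<Rightarrow> 'k))"
  by unfold_locales (auto simp: tensor_scale_def fun_eq_iff algebra_simps)

lemma linear_functional_separates:
  assumes "vector_space sW" "w \<noteq> 0"
  shows "\<exists>\<omega>. Vector_Spaces.linear sW ((*) :: 'k::field \<Rightarrow> 'k \<Rightarrow> 'k) \<omega> \<and> \<omega> w \<noteq> 0"
proof -
  interpret W: vector_space sW by fact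
  interpret vector_space_pair sW "(*) :: 'k \<Rightarrow> 'k \<Rightarrow> 'k"
    by unfold_locales (auto simp: algebra_simps)
  have "W.independent {w}" using assms(2) by simp
  from linear_independent_extend[OF this, of "\<lambda>_. 1"] show ?thesis by auto
qed

lemma bilinear_map_compose:
  assumes "bilinear_map s sW \<phi>" "Vector_Spaces.linear sW sV \<omega>"
  shows "bilinear_map s sV (\<lambda>a b. \<omega> (\<phi> a b))"
  using assms Vector_Spaces.linear_compose[of s sW _ sV \<omega>] unfolding bilinear_map_def comp_def by blast

lemma trilinear_map_compose:
  assumes "trilinear_map s sW \<phi>" "Vector_Spaces.linear sW sV \<omega>"
  shows "trilinear_map s sV (\<lambda>a b c. \<omega> (\<phi> a b c))"
  using assms Vector_Spaces.linear_compose[of s sW _ sV \<omega>] unfolding trilinear_map_def comp_def by blast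

lemma sum_list_tensor_apply:
  "bilinear_map s (*) B \<Longrightarrow> (\<Sum>(a, b)\<leftarrow>xs. a \<otimes>\<^bsub>s\<^esub> b) B = (\<Sum>(a, b)\<leftarrow>xs. B a b)"
  by (induction xs) (auto simp: tensor_def)

lemma sum_list_tensor3_apply:
  "trilinear_map s (*) B \<Longrightarrow> (\<Sum>(a, b, c)\<leftarrow>xs. tensor3 s a b c) B = (\<Sum>(a, b, c)\<leftarrow>xs. B a b c)"
  by (induction xs) (auto simp: tensor3_def)

lemma linear_sum_list:
  assumes "Vector_Spaces.linear sW sV \<omega>"
  shows "\<omega> (\<Sum>x\<leftarrow>xs. h x) = (\<Sum>x\<leftarrow>xs. \<omega> (h x))"
proof -
  interpret Vector_Spaces.linear sW sV \<omega> by fact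
  show ?thesis by (induction xs) (auto simp: add zero)
qed

lemma tensor_relations_universal:
  assumes \<phi>: "bilinear_map s sW \<phi>"
    and eq: "(\<Sum>(a, b)\<leftarrow>xs. a \<otimes>\<^bsub>s\<^esub> b) = (\<Sum>(a, b)\<leftarrow>ys. a \<otimes>\<^bsub>s\<^esub> b)"
  shows "(\<Sum>(a, b)\<leftarrow>xs. \<phi> a b) = (\<Sum>(a, b)\<leftarrow>ys. \<phi> a b)"
proof (rule ccontr)
  let ?S = "\<lambda>zs. \<Sum>(a, b)\<leftarrow>zs. \<phi> a b"
  assume "?S xs \<noteq> ?S ys"
  moreover have "vector_space sW" using \<phi> by (auto simp: bilinear_map_def Vector_Spaces.linear_def)
  ultimately obtain \<omega> where \<omega>: "Vector_Spaces.linear sW (*) \<omega>" and ne: "\<omega> (?S xs - ?S ys) \<noteq> 0"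
    using linear_functional_separates[of sW "?S xs - ?S ys"] by auto
  interpret Vector_Spaces.linear sW "(*)" \<omega> by fact
  have "\<omega> (?S zs) = (\<Sum>(a, b)\<leftarrow>zs. a \<otimes>\<^bsub>s\<^esub> b) (\<lambda>a b. \<omega> (\<phi> a b))" for zs
    using sum_list_tensor_apply[OF bilinear_map_compose[OF \<phi> \<omega>], of zs]
    by (simp add: linear_sum_list[OF \<omega>] case_prod_unfold)
  with eq ne show False by (simp add: diff)
qed

lemma tensor3_relations_universal:
  assumes \<phi>: "trilinear_map s sW \<phi>"
    and eq: "(\<Sum>(a, b, c)\<leftarrow>xs. tensor3 s a b c) = (\<Sum>(a, b, c)\<leftarrow>ys. tensor3 s a b c)"
  shows "(\<Sum>(a, b, c)\<leftarrow>xs. \<phi> a b c) = (\<Sum>(a, b, c)\<leftarrow>ys. \<phi> a b c)"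
proof (rule ccontr)
  let ?S = "\<lambda>zs. \<Sum>(a, b, c)\<leftarrow>zs. \<phi> a b c"
  assume "?S xs \<noteq> ?S ys"
  moreover have "vector_space sW" using \<phi> by (auto simp: trilinear_map_def Vector_Spaces.linear_def)
  ultimately obtain \<omega> where \<omega>: "Vector_Spaces.linear sW (*) \<omega>" and ne: "\<omega> (?S xs - ?S ys) \<noteq> 0"
    using linear_functional_separates[of sW "?S xs - ?S ys"] by auto
  interpret Vector_Spaces.linear sW "(*)" \<omega> by fact
  have "\<omega> (?S zs) = (\<Sum>(a, b, c)\<leftarrow>zs. tensor3 s a b c) (\<lambda>a b c. \<omega> (\<phi> a b c))" for zs
    using sum_list_tensor3_apply[OF trilinear_map_compose[OF \<phi> \<omega>], of zs]
    by (simp add: linear_sum_list[OF \<omega>] case_prod_unfold)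
  with eq ne show False by (simp add: diff)
qed

lemma sweedler_sum_list:
  assumes "bilinear_map s sW \<phi>"
  shows "sweedler s (\<Sum>(a, b)\<leftarrow>xs. a \<otimes>\<^bsub>s\<^esub> b) \<phi> = (\<Sum>(a, b)\<leftarrow>xs. \<phi> a b)"
  unfolding sweedler_def
  by (rule the_equality) (blast, metis tensor_relations_universal[OF assms])

lemma sweedler_tensor: "bilinear_map s sW \<phi> \<Longrightarrow> sweedler s (a \<otimes>\<^bsub>s\<^esub> b) \<phi> = \<phi> a b"
  using sweedler_sum_list[of s sW \<phi> "[(a, b)]"] by simp

lemma tensor_scale_left:
  assumes "vector_space s"
  shows "tensor_scale c (a \<otimes>\<^bsub>s\<^esub> b) = s c a \<otimes>\<^bsub>s\<^esub> b"
proof -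
  have "B (s c a) b = c * B a b" if "bilinear_map s (*) B" for B
    using that by (auto simp: bilinear_map_def Vector_Spaces.linear_def module_hom_def module_hom_axioms_def)
  then show ?thesis by (auto simp: tensor_def tensor_scale_def fun_eq_iff)
qed

lemma bilinear_map_tensor:
  assumes "vector_space s"
  shows "bilinear_map s tensor_scale (tensor s)"
proof -
  interpret V: vector_space s by fact
  interpret T: vector_space "tensor_scale :: 'a \<Rightarrow> ('b, 'a) tensor2 \<Rightarrow> ('b, 'a) tensor2"
    by (rule vector_space_tensor_scale)
  have add: "B (a + a') b = B a b + B a' b" "B a (b + b') = B a b + B a b'"
    and sc: "B (s c a) b = c * B a b" "B a (s c b) = c * B a b"
    if "bilinear_map s (*) B" for B c a a' b b'
    using that by (auto simp: bilinear_map_def Vector_Spaces.linear_def module_hom_def module_hom_axioms_def)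
  show ?thesis unfolding bilinear_map_def
    by (intro conjI allI; unfold_locales)
      (auto simp: tensor_def tensor_scale_def fun_eq_iff add sc)
qed

lemma trilinear_map_tensor3:
  assumes "vector_space s"
  shows "trilinear_map s tensor_scale (tensor3 s)"
proof -
  interpret V: vector_space s by fact
  interpret T: vector_space "tensor_scale :: 'a \<Rightarrow> ('b, 'a) tensor3 \<Rightarrow> ('b, 'a) tensor3"
    by (rule vector_space_tensor_scale)
  have add: "B (a + a') b c = B a b c + B a' b c" "B a (b + b') c = B a b c + B a b' c"
      "B a b (c + c') = B a b c + B a b c'"
    and sc: "B (s r a) b c = r * B a b c" "B a (s r b) c = r * B a b c" "B a b (s r c) = r * B a b c"
    if "trilinear_map s (*) B" for B r a a' b b' c c'
    using that by (auto simp: trilinear_map_def Vector_Spaces.linear_def module_hom_def module_hom_axioms_def)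
  show ?thesis unfolding trilinear_map_def
    by (intro conjI allI; unfold_locales)
      (auto simp: tensor3_def tensor_scale_def fun_eq_iff add sc)
qed

lemma tensor_scale_sum_list:
  assumes "vector_space s"
  shows "tensor_scale c (\<Sum>(a, b)\<leftarrow>xs. a \<otimes>\<^bsub>s\<^esub> b) =
    (\<Sum>(a, b)\<leftarrow>map (\<lambda>(a, b). (s c a, b)) xs. a \<otimes>\<^bsub>s\<^esub> b)"
proof -
  interpret T: vector_space "tensor_scale :: 'a \<Rightarrow> ('b, 'a) tensor2 \<Rightarrow> ('b, 'a) tensor2"
    by (rule vector_space_tensor_scale)
  show ?thesis
    by (induction xs)
      (simp_all only: list.map sum_list.Nil sum_list.Cons T.scale_zero_right T.scale_right_distrib
        case_prod_unfold tensor_scale_left[OF assms] fst_conv snd_conv)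
qed

lemma tensor_square_eq_sums:
  assumes "vector_space s"
  shows "tensor_square s = range (\<lambda>xs. \<Sum>(a, b)\<leftarrow>xs. a \<otimes>\<^bsub>s\<^esub> b)"
proof -
  interpret T: vector_space "tensor_scale :: 'a \<Rightarrow> ('b, 'a) tensor2 \<Rightarrow> ('b, 'a) tensor2"
    by (rule vector_space_tensor_scale)
  let ?R = "range (\<lambda>xs. \<Sum>(a, b)\<leftarrow>xs. a \<otimes>\<^bsub>s\<^esub> b)"
  have "T.subspace ?R"
  proof (rule T.subspaceI)
    show "0 \<in> ?R" by (rule range_eqI[of _ _ "[]"]) simp
  next
    fix x y assume "x \<in> ?R" "y \<in> ?R"
    then obtain xs ys where "x = (\<Sum>(a, b)\<leftarrow>xs. a \<otimes>\<^bsub>s\<^esub> b)" "y = (\<Sum>(a, b)\<leftarrow>ys. a \<otimes>\<^bsub>s\<^esub> b)" by blast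
    then show "x + y \<in> ?R" by (intro range_eqI[of _ _ "xs @ ys"]) simp
  next
    fix c x assume "x \<in> ?R"
    then show "tensor_scale c x \<in> ?R" using tensor_scale_sum_list[OF assms] by blast
  qed
  moreover have "{x \<otimes>\<^bsub>s\<^esub> y | x y. True} \<subseteq> ?R"
  proof safe
    fix x y show "x \<otimes>\<^bsub>s\<^esub> y \<in> ?R" by (rule range_eqI[of _ _ "[(x, y)]"]) simp
  qed
  ultimately have "tensor_square s \<subseteq> ?R"
    unfolding tensor_square_def by (rule T.span_minimal[rotated])
  moreover have "(\<Sum>(a, b)\<leftarrow>xs. a \<otimes>\<^bsub>s\<^esub> b) \<in> tensor_square s" for xs
    unfolding tensor_square_def
  proof (induction xs)
    case Nil
    show ?case unfolding list.map sum_list.Nil by (rule T.span_zero)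
  next
    case (Cons p xs)
    show ?case unfolding list.map sum_list.Cons
      by (intro T.span_add Cons.IH T.span_base) (auto simp: case_prod_unfold)
  qed
  ultimately show ?thesis by auto
qed

lemma sweedler_add:
  assumes "bilinear_map s sW \<phi>" "t \<in> tensor_square s" "u \<in> tensor_square s"
  shows "sweedler s (t + u) \<phi> = sweedler s t \<phi> + sweedler s u \<phi>"
proof -
  have "vector_space s" using assms(1) by (auto simp: bilinear_map_def Vector_Spaces.linear_def)
  then obtain xs ys where "t = (\<Sum>(a, b)\<leftarrow>xs. a \<otimes>\<^bsub>s\<^esub> b)" "u = (\<Sum>(a, b)\<leftarrow>ys. a \<otimes>\<^bsub>s\<^esub> b)"
    using assms(2,3) by (auto simp: tensor_square_eq_sums)
  then show ?thesis
    using sweedler_sum_list[OF assms(1), of "xs @ ys"] by (simp add: sweedler_sum_list[OF assms(1)])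
qed

lemma sweedler_scale:
  assumes "bilinear_map s sW \<phi>" "t \<in> tensor_square s"
  shows "sweedler s (tensor_scale c t) \<phi> = sW c (sweedler s t \<phi>)"
proof -
  have s: "vector_space s" and W: "vector_space sW"
    using assms(1) by (auto simp: bilinear_map_def Vector_Spaces.linear_def)
  interpret W: vector_space sW by fact
  obtain xs where xs: "t = (\<Sum>(a, b)\<leftarrow>xs. a \<otimes>\<^bsub>s\<^esub> b)"
    using assms(2) s by (auto simp: tensor_square_eq_sums)
  have "\<phi> (s c a) b = sW c (\<phi> a b)" for a b
    using assms(1) by (auto simp: bilinear_map_def Vector_Spaces.linear_def module_hom_def module_hom_axioms_def)
  then have "(\<Sum>(a, b)\<leftarrow>map (\<lambda>(a, b). (s c a, b)) xs. \<phi> a b) = sW c (\<Sum>(a, b)\<leftarrow>xs. \<phi> a b)"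
    by (induction xs) (auto simp: W.scale_right_distrib)
  then show ?thesis
    unfolding xs tensor_scale_sum_list[OF s] sweedler_sum_list[OF assms(1)] .
qed

subsection \<open>Induced maps on tensors\<close>

definition flip :: "('k::field \<Rightarrow> 'a::ab_group_add \<Rightarrow> 'a) \<Rightarrow> ('a, 'k) tensor2 \<Rightarrow> ('a, 'k) tensor2"
  where "flip s t = sweedler s t (\<lambda>a b. b \<otimes>\<^bsub>s\<^esub> a)"

definition map_tensor :: "('k::field \<Rightarrow> 'a::ab_group_add \<Rightarrow> 'a) \<Rightarrow> ('a \<Rightarrow> 'a) \<Rightarrow> ('a \<Rightarrow> 'a) \<Rightarrow>
    ('a, 'k) tensor2 \<Rightarrow> ('a, 'k) tensor2"
  where "map_tensor s f g t = sweedler s t (\<lambda>a b. f a \<otimes>\<^bsub>s\<^esub> g b)"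


section \<open>Commutative and cocommutative associative D-bialgebras\<close>

definition comm_assoc_algebra ::
  "('k::field \<Rightarrow> 'a::ab_group_add \<Rightarrow> 'a) \<Rightarrow> ('a \<Rightarrow> 'a \<Rightarrow> 'a) \<Rightarrow> bool"
  where "comm_assoc_algebra s m \<longleftrightarrow> bilinear_map s s m \<and>
    (\<forall>x y. m x y = m y x) \<and> (\<forall>x y z. m (m x y) z = m x (m y z))"

definition comultiplication ::
  "('k::field \<Rightarrow> 'a::ab_group_add \<Rightarrow> 'a) \<Rightarrow> ('a \<Rightarrow> ('a, 'k) tensor2) \<Rightarrow> bool"
  where "comultiplication s \<delta> \<longleftrightarrow>
    Vector_Spaces.linear s tensor_scale \<delta> \<and> (\<forall>x. \<delta> x \<in> tensor_square s)"

text \<open>The last conjunct is \<open>(\<delta> \<otimes> id) \<delta> = (id \<otimes> \<delta>) \<delta>\<close>; there is no counit.\<close>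

definition cocomm_coassoc_coalgebra ::
  "('k::field \<Rightarrow> 'a::ab_group_add \<Rightarrow> 'a) \<Rightarrow> ('a \<Rightarrow> ('a, 'k) tensor2) \<Rightarrow> bool"
  where "cocomm_coassoc_coalgebra s \<delta> \<longleftrightarrow> comultiplication s \<delta> \<and>
    (\<forall>x. flip s (\<delta> x) = \<delta> x) \<and>
    (\<forall>x. sweedler s (\<delta> x) (\<lambda>x1 x2. sweedler s (\<delta> x1) (\<lambda>x11 x12. tensor3 s x11 x12 x2)) =
         sweedler s (\<delta> x) (\<lambda>x1 x2. sweedler s (\<delta> x2) (\<lambda>x21 x22. tensor3 s x1 x21 x22)))"

definition comm_cocomm_assoc_D_bialgebra ::
  "('k::field \<Rightarrow> 'a::ab_group_add \<Rightarrow> 'a) \<Rightarrow> ('a \<Rightarrow> 'a \<Rightarrow> 'a) \<Rightarrow> ('a \<Rightarrow> ('a, 'k) tensor2) \<Rightarrow> bool"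
  where "comm_cocomm_assoc_D_bialgebra s m \<delta> \<longleftrightarrow>
    comm_assoc_algebra s m \<and> cocomm_coassoc_coalgebra s \<delta> \<and>
    (\<forall>a b. \<delta> (m a b) =
      sweedler s (\<delta> a) (\<lambda>a1 a2. m a1 b \<otimes>\<^bsub>s\<^esub> a2) +
      sweedler s (\<delta> b) (\<lambda>b1 b2. b1 \<otimes>\<^bsub>s\<^esub> m a b2))"


section \<open>Left Alia bialgebras\<close>

definition left_Alia_algebra ::
  "('k::field \<Rightarrow> 'a::ab_group_add \<Rightarrow> 'a) \<Rightarrow> ('a \<Rightarrow> 'a \<Rightarrow> 'a) \<Rightarrow> bool"
  where "left_Alia_algebra s br \<longleftrightarrow> bilinear_map s s br \<and>
    (\<forall>x y z. br (br x y) z + br (br y z) x + br (br z x) y =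
             br (br y x) z + br (br z y) x + br (br x z) y)"

text \<open>\<open>cosplit s \<Delta> x \<psi>\<close> is \<open>\<psi> x\<^sub>(\<^sub>1\<^sub>)\<^sub>(\<^sub>1\<^sub>) x\<^sub>(\<^sub>1\<^sub>)\<^sub>(\<^sub>2\<^sub>) x\<^sub>(\<^sub>2\<^sub>)\<close>, the image of
  \<open>(\<Delta> \<otimes> id) (\<Delta> x)\<close> under the linear map induced by the trilinear map \<open>\<psi>\<close>.\<close>

definition cosplit ::
  "('k::field \<Rightarrow> 'a::ab_group_add \<Rightarrow> 'a) \<Rightarrow> ('a \<Rightarrow> ('a, 'k) tensor2) \<Rightarrow> 'a \<Rightarrow>
    ('a \<Rightarrow> 'a \<Rightarrow> 'a \<Rightarrow> 'w::ab_group_add) \<Rightarrow> 'w"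
  where "cosplit s \<Delta> x \<psi> =
    sweedler s (\<Delta> x) (\<lambda>x1 x2. sweedler s (\<Delta> x1) (\<lambda>x11 x12. \<psi> x11 x12 x2))"

definition left_Alia_coalgebra ::
  "('k::field \<Rightarrow> 'a::ab_group_add \<Rightarrow> 'a) \<Rightarrow> ('a \<Rightarrow> ('a, 'k) tensor2) \<Rightarrow> bool"
  where "left_Alia_coalgebra s \<Delta> \<longleftrightarrow> comultiplication s \<Delta> \<and>
    (\<forall>x. cosplit s \<Delta> x (\<lambda>x11 x12 x2. tensor3 s x12 x11 x2) +
         cosplit s \<Delta> x (\<lambda>x11 x12 x2. tensor3 s x11 x2 x12) +
         cosplit s \<Delta> x (\<lambda>x11 x12 x2. tensor3 s x2 x12 x11) =
         cosplit s \<Delta> x (\<lambda>x11 x12 x2. tensor3 s x11 x12 x2) +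
         cosplit s \<Delta> x (\<lambda>x11 x12 x2. tensor3 s x12 x2 x11) +
         cosplit s \<Delta> x (\<lambda>x11 x12 x2. tensor3 s x2 x11 x12))"

definition flip_minus_id ::
  "('k::field \<Rightarrow> 'a::ab_group_add \<Rightarrow> 'a) \<Rightarrow> ('a, 'k) tensor2 \<Rightarrow> ('a, 'k) tensor2"
  where "flip_minus_id s t = flip s t - t"

definition left_Alia_bialgebra ::
  "('k::field \<Rightarrow> 'a::ab_group_add \<Rightarrow> 'a) \<Rightarrow> ('a \<Rightarrow> 'a \<Rightarrow> 'a) \<Rightarrow> ('a \<Rightarrow> ('a, 'k) tensor2) \<Rightarrow> bool"
  where "left_Alia_bialgebra s br \<Delta> \<longleftrightarrow>
    left_Alia_algebra s br \<and> left_Alia_coalgebra s \<Delta> \<and>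
    (\<forall>x y. flip_minus_id s (\<Delta> (br x y - br y x)) =
           flip_minus_id s (map_tensor s (\<lambda>z. br z y) id (\<Delta> x) - map_tensor s (\<lambda>z. br z x) id (\<Delta> y)))"


section \<open>The bracket and cobracket induced by linear maps\<close>

definition bracket_fg ::
  "('a \<Rightarrow> 'a \<Rightarrow> 'a::ab_group_add) \<Rightarrow> ('a \<Rightarrow> 'a) \<Rightarrow> ('a \<Rightarrow> 'a) \<Rightarrow> 'a \<Rightarrow> 'a \<Rightarrow> 'a"
  where "bracket_fg m f g x y = m x (f y) + g (m x y)"

definition cobracket_FG ::
  "('k::field \<Rightarrow> 'a::ab_group_add \<Rightarrow> 'a) \<Rightarrow> ('a \<Rightarrow> ('a, 'k) tensor2) \<Rightarrow> ('a \<Rightarrow> 'a) \<Rightarrow> ('a \<Rightarrow> 'a) \<Rightarrow>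
    'a \<Rightarrow> ('a, 'k) tensor2"
  where "cobracket_FG s \<delta> F G x = sweedler s (\<delta> x) (\<lambda>x1 x2. x1 \<otimes>\<^bsub>s\<^esub> F x2) + \<delta> (G x)"

end

theory Submission
  imports Defs
begin

text \<open>Of the three conditions on a left Alia bialgebra, the first two hold for every choice of \<open>f\<close>,
  \<open>g\<close>, \<open>F\<close>, \<open>G\<close>, and the third is the displayed equation.

  The algebra and the coalgebra conditions say that antisymmetrising an iterated (co)bracket over
  all six permutations gives zero. For the bracket, \<open>[x, y] - [y, x] = x \<cdot> f y - y \<cdot> f x\<close>,
  and bracketing with \<open>z\<close> leaves terms that cancel in pairs
  (\<open>left_Alia_algebra_bracket_fg\<close>). For the cobracket, cocommutativity and coassociativity make the
  iterated comultiplication of \<open>\<delta>\<close> invariant under all permutations of its three legs. Therefore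
  \<open>(\<Delta> \<otimes> id) (\<Delta> x)\<close> is a sum of parts, each of them invariant under some transposition of
  the legs: two legs that carry the same one of the maps \<open>F\<close> and \<open>id\<close>, or that come out of the
  same \<open>\<delta> (G x\<^sub>1)\<close> unchanged (\<open>cosplit_cobracket_FG\<close>). The
  antisymmetriser kills a tensor that is invariant under a transposition, so it kills every part
  (\<open>left_Alia_coalgebra_cobracket_FG\<close>).

  In the compatibility condition everything is seen through \<open>\<tau> - id\<close>, which kills the image
  of \<open>\<delta>\<close> by cocommutativity. Expanding \<open>\<delta> (x \<cdot> f y)\<close> by the D-bialgebra identity, the term
  \<open>x\<^sub>1 \<cdot> f y \<otimes> F x\<^sub>2\<close> appears on both sides and cancels. The remaining four tensors and
  their counterparts with \<open>x\<close> and \<open>y\<close> exchanged each contribute two terms, a tensor and its flip: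
  these are the sixteen terms.

  The computations with Sweedler sums rest on the fact that a bilinear map induces a linear map
  on \<open>A \<otimes> A\<close> that may be composed, added and made to depend linearly on parameters. Every such
  rule has a bilinearity premise, since a Sweedler sum has a meaning only for bilinear maps.\<close>

section \<open>Multilinear maps\<close>

lemma linear_map_iff:
  "Vector_Spaces.linear s sW h \<longleftrightarrow> vector_space s \<and> vector_space sW \<and>
    (\<forall>x y. h (x + y) = h x + h y) \<and> (\<forall>c x. h (s c x) = sW c (h x))"
  by (auto simp: Vector_Spaces.linear_def module_hom_def module_hom_axioms_def
      module_def vector_space_def)

lemma bilinear_map_iff:
  "bilinear_map s sW \<phi> \<longleftrightarrow> vector_space s \<and> vector_space sW \<and>
    (\<forall>x x' y. \<phi> (x + x') y = \<phi> x y + \<phi> x' y) \<and> (\<forall>x y y'. \<phi> x (y + y') = \<phi> x y + \<phi> x y') \<and>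
    (\<forall>c x y. \<phi> (s c x) y = sW c (\<phi> x y)) \<and> (\<forall>c x y. \<phi> x (s c y) = sW c (\<phi> x y))"
  unfolding bilinear_map_def linear_map_iff by metis

lemma trilinear_map_iff:
  "trilinear_map s sW \<psi> \<longleftrightarrow> vector_space s \<and> vector_space sW \<and>
    (\<forall>x x' y z. \<psi> (x + x') y z = \<psi> x y z + \<psi> x' y z) \<and>
    (\<forall>x y y' z. \<psi> x (y + y') z = \<psi> x y z + \<psi> x y' z) \<and>
    (\<forall>x y z z'. \<psi> x y (z + z') = \<psi> x y z + \<psi> x y z') \<and>
    (\<forall>c x y z. \<psi> (s c x) y z = sW c (\<psi> x y z)) \<and>
    (\<forall>c x y z. \<psi> x (s c y) z = sW c (\<psi> x y z)) \<and>
    (\<forall>c x y z. \<psi> x y (s c z) = sW c (\<psi> x y z))"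
  unfolding trilinear_map_def linear_map_iff by (safe; simp)

lemma bilinear_map_tensor_compose:
  assumes "Vector_Spaces.linear s s h" "Vector_Spaces.linear s s k"
  shows "bilinear_map s tensor_scale (\<lambda>a b. h a \<otimes>\<^bsub>s\<^esub> k b)"
    and "bilinear_map s tensor_scale (\<lambda>a b. k b \<otimes>\<^bsub>s\<^esub> h a)"
  using assms bilinear_map_tensor[of s] by (simp_all add: linear_map_iff bilinear_map_iff)


section \<open>Calculus of Sweedler sums\<close>

lemma tensor_square_sum_listE:
  assumes "vector_space s" "t \<in> tensor_square s"
  obtains xs where "t = (\<Sum>(a, b)\<leftarrow>xs. a \<otimes>\<^bsub>s\<^esub> b)"
  using assms by (auto simp: tensor_square_eq_sums)

lemma tensor_square_closed:
  fixes s :: "'k::field \<Rightarrow> 'a::ab_group_add \<Rightarrow> 'a"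
  assumes "t \<in> tensor_square s" "u \<in> tensor_square s"
  shows "t + u \<in> tensor_square s" and "t - u \<in> tensor_square s"
proof -
  interpret T: vector_space "tensor_scale :: 'k \<Rightarrow> ('a, 'k) tensor2 \<Rightarrow> ('a, 'k) tensor2"
    by (rule vector_space_tensor_scale)
  show "t + u \<in> tensor_square s" "t - u \<in> tensor_square s"
    using assms by (simp_all add: tensor_square_def T.span_add T.span_diff)
qed

lemma tensor_in_tensor_square:
  fixes s :: "'k::field \<Rightarrow> 'a::ab_group_add \<Rightarrow> 'a"
  shows "a \<otimes>\<^bsub>s\<^esub> b \<in> tensor_square s"
proof -
  interpret T: vector_space "tensor_scale :: 'k \<Rightarrow> ('a, 'k) tensor2 \<Rightarrow> ('a, 'k) tensor2"
    by (rule vector_space_tensor_scale)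
  show ?thesis unfolding tensor_square_def by (rule T.span_base) blast
qed

lemma sweedler_diff:
  assumes "bilinear_map s sW \<phi>" "t \<in> tensor_square s" "u \<in> tensor_square s"
  shows "sweedler s (t - u) \<phi> = sweedler s t \<phi> - sweedler s u \<phi>"
  using sweedler_add[OF assms(1) tensor_square_closed(2)[OF assms(2,3)] assms(3)] by simp

lemma sweedler_plus:
  assumes \<phi>: "bilinear_map s sW \<phi>" and \<chi>: "bilinear_map s sW \<chi>" and t: "t \<in> tensor_square s"
  shows "sweedler s t (\<lambda>a b. \<phi> a b + \<chi> a b) = sweedler s t \<phi> + sweedler s t \<chi>"
proof -
  have s: "vector_space s" using \<phi> by (simp add: bilinear_map_iff)
  obtain xs where xs: "t = (\<Sum>(a, b)\<leftarrow>xs. a \<otimes>\<^bsub>s\<^esub> b)" using s t by (rule tensor_square_sum_listE)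
  have "bilinear_map s sW (\<lambda>a b. \<phi> a b + \<chi> a b)"
    using \<phi> \<chi> by (auto simp: bilinear_map_iff algebra_simps vector_space.vector_space_assms)
  then show ?thesis
    unfolding xs sweedler_sum_list[OF \<phi>] sweedler_sum_list[OF \<chi>]
    by (subst sweedler_sum_list) (auto simp: case_prod_unfold sum_list_addf)
qed

lemma sweedler_in_tensor_square:
  assumes \<chi>: "bilinear_map s tensor_scale (\<lambda>a b. p a b \<otimes>\<^bsub>s\<^esub> q a b)" and t: "t \<in> tensor_square s"
  shows "sweedler s t (\<lambda>a b. p a b \<otimes>\<^bsub>s\<^esub> q a b) \<in> tensor_square s"
proof -
  have s: "vector_space s" using \<chi> by (simp add: bilinear_map_iff)
  obtain xs where xs: "t = (\<Sum>(a, b)\<leftarrow>xs. a \<otimes>\<^bsub>s\<^esub> b)" using s t by (rule tensor_square_sum_listE)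
  have "sweedler s t (\<lambda>a b. p a b \<otimes>\<^bsub>s\<^esub> q a b) =
      (\<Sum>(a, b)\<leftarrow>map (\<lambda>(a, b). (p a b, q a b)) xs. a \<otimes>\<^bsub>s\<^esub> b)"
    unfolding xs sweedler_sum_list[OF \<chi>] by (simp add: comp_def case_prod_unfold)
  then show ?thesis using s by (simp only: tensor_square_eq_sums) blast
qed

text \<open>Induced linear maps compose. The flip, maps of the form \<open>h \<otimes> k\<close> and the summand
  \<open>x\<^sub>1 \<otimes> F x\<^sub>2\<close> of the cobracket are all Sweedler sums of pure tensors, so this one rule
  evaluates Sweedler sums over any of them.\<close>

lemma sweedler_sweedler:
  assumes \<chi>: "bilinear_map s tensor_scale (\<lambda>a b. p a b \<otimes>\<^bsub>s\<^esub> q a b)"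
    and \<phi>: "bilinear_map s sW \<phi>" and t: "t \<in> tensor_square s"
  shows "sweedler s (sweedler s t (\<lambda>a b. p a b \<otimes>\<^bsub>s\<^esub> q a b)) \<phi> = sweedler s t (\<lambda>a b. \<phi> (p a b) (q a b))"
proof -
  have s: "vector_space s" using \<chi> by (simp add: bilinear_map_iff)
  obtain xs where xs: "t = (\<Sum>(a, b)\<leftarrow>xs. a \<otimes>\<^bsub>s\<^esub> b)" using s t by (rule tensor_square_sum_listE)
  have "\<phi> (p a b) (q a b) = sweedler s (p a b \<otimes>\<^bsub>s\<^esub> q a b) \<phi>" for a b
    by (simp add: sweedler_tensor[OF \<phi>])
  then have comp: "bilinear_map s sW (\<lambda>a b. \<phi> (p a b) (q a b))"
    using \<chi> \<phi> unfolding bilinear_map_iff[of s sW "\<lambda>a b. \<phi> (p a b) (q a b)"]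
    by (simp add: bilinear_map_iff[of s tensor_scale] bilinear_map_iff[of s sW \<phi>]
        sweedler_add[OF \<phi>] sweedler_scale[OF \<phi>] tensor_in_tensor_square)
  have "sweedler s t (\<lambda>a b. p a b \<otimes>\<^bsub>s\<^esub> q a b) =
      (\<Sum>(a, b)\<leftarrow>map (\<lambda>(a, b). (p a b, q a b)) xs. a \<otimes>\<^bsub>s\<^esub> b)"
    unfolding xs sweedler_sum_list[OF \<chi>] by (simp add: comp_def case_prod_unfold)
  then have "sweedler s (sweedler s t (\<lambda>a b. p a b \<otimes>\<^bsub>s\<^esub> q a b)) \<phi> =
      (\<Sum>(a, b)\<leftarrow>map (\<lambda>(a, b). (p a b, q a b)) xs. \<phi> a b)"
    by (simp only: sweedler_sum_list[OF \<phi>])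
  also have "\<dots> = sweedler s t (\<lambda>a b. \<phi> (p a b) (q a b))"
    unfolding xs sweedler_sum_list[OF comp] by (simp add: comp_def case_prod_unfold)
  finally show ?thesis .
qed

lemma linear_sweedler_comultiplication:
  assumes "comultiplication s \<Delta>" "bilinear_map s sW \<phi>"
  shows "Vector_Spaces.linear s sW (\<lambda>x. sweedler s (\<Delta> x) \<phi>)"
  using assms
  by (simp add: comultiplication_def linear_map_iff sweedler_add sweedler_scale)
    (simp add: bilinear_map_iff)

text \<open>Linearity in the summand. Together with linearity of \<open>x \<mapsto> \<Delta> x\<close> it makes the outer sum in a
  nested Sweedler expression meaningful.\<close>

lemma linear_sweedler_parameter:
  assumes \<psi>: "\<And>y. bilinear_map s sW (\<psi> y)" "\<And>a b. Vector_Spaces.linear s sW (\<lambda>y. \<psi> y a b)"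
    and t: "t \<in> tensor_square s"
  shows "Vector_Spaces.linear s sW (\<lambda>y. sweedler s t (\<psi> y))"
proof -
  have s: "vector_space s" and W: "vector_space sW" using \<psi>(2) by (auto simp: linear_map_iff)
  interpret W: vector_space sW by fact
  obtain xs where xs: "t = (\<Sum>(a, b)\<leftarrow>xs. a \<otimes>\<^bsub>s\<^esub> b)" using s t by (rule tensor_square_sum_listE)
  have add: "\<psi> (x + y) a b = \<psi> x a b + \<psi> y a b" and scale: "\<psi> (s c x) a b = sW c (\<psi> x a b)" for x y a b c
    using \<psi>(2) by (simp_all add: linear_map_iff)
  have "(\<Sum>(a, b)\<leftarrow>xs. \<psi> (x + y) a b) = (\<Sum>(a, b)\<leftarrow>xs. \<psi> x a b) + (\<Sum>(a, b)\<leftarrow>xs. \<psi> y a b)" for x y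
    by (simp add: add case_prod_unfold sum_list_addf)
  moreover have "(\<Sum>(a, b)\<leftarrow>xs. \<psi> (s c x) a b) = sW c (\<Sum>(a, b)\<leftarrow>xs. \<psi> x a b)" for c x
    by (induction xs) (auto simp: scale W.scale_right_distrib)
  ultimately show ?thesis
    using s W by (simp add: linear_map_iff xs sweedler_sum_list[OF \<psi>(1)])
qed

lemma bilinear_map_cosplit:
  assumes \<Delta>: "comultiplication s \<Delta>" and \<psi>: "trilinear_map s sW \<psi>"
  shows "bilinear_map s sW (\<lambda>x y. sweedler s (\<Delta> x) (\<lambda>a b. \<psi> a b y))"
    and "bilinear_map s sW (\<lambda>x y. sweedler s (\<Delta> y) (\<lambda>a b. \<psi> x a b))"
proof -
  have sq: "\<Delta> x \<in> tensor_square s" for x using \<Delta> by (simp add: comultiplication_def)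
  have bil: "bilinear_map s sW (\<lambda>a b. \<psi> a b y)" "bilinear_map s sW (\<psi> y)" for y
    using \<psi> by (simp_all add: trilinear_map_iff bilinear_map_iff)
  have lin: "Vector_Spaces.linear s sW (\<lambda>y. \<psi> a b y)" "Vector_Spaces.linear s sW (\<lambda>y. \<psi> y a b)" for a b
    using \<psi> by (simp_all add: trilinear_map_iff linear_map_iff)
  show "bilinear_map s sW (\<lambda>x y. sweedler s (\<Delta> x) (\<lambda>a b. \<psi> a b y))"
    unfolding bilinear_map_def
    by (intro conjI allI linear_sweedler_comultiplication[OF \<Delta>] linear_sweedler_parameter bil lin sq)
  show "bilinear_map s sW (\<lambda>x y. sweedler s (\<Delta> y) (\<lambda>a b. \<psi> x a b))"
    unfolding bilinear_map_def
    by (intro conjI allI linear_sweedler_comultiplication[OF \<Delta>] linear_sweedler_parameter bil lin sq)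
qed


section \<open>Symmetry of iterated cocommutative comultiplications\<close>

lemma sweedler_cocommutative:
  assumes "cocomm_coassoc_coalgebra s \<delta>" and \<phi>: "bilinear_map s sW \<phi>"
  shows "sweedler s (\<delta> x) \<phi> = sweedler s (\<delta> x) (\<lambda>a b. \<phi> b a)"
proof -
  have sq: "\<delta> x \<in> tensor_square s" and flip: "flip s (\<delta> x) = \<delta> x"
    using assms(1) by (auto simp: cocomm_coassoc_coalgebra_def comultiplication_def)
  have "bilinear_map s tensor_scale (\<lambda>a b. b \<otimes>\<^bsub>s\<^esub> a)"
    using bilinear_map_tensor[of s] \<phi> by (simp add: bilinear_map_iff)
  from sweedler_sweedler[OF this \<phi> sq] flip show ?thesis by (simp only: flip_def)
qed

text \<open>Coassociativity is an equation in \<open>A \<otimes> A \<otimes> A\<close>, while the maps \<open>F\<close> sit on the legs of the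
  iterated comultiplications to which it is applied; a version under arbitrary trilinear maps
  covers these, as well as all permutations of the legs.\<close>

lemma cosplit_coassociative:
  assumes coalg: "cocomm_coassoc_coalgebra s \<delta>" and \<psi>: "trilinear_map s sW \<psi>"
  shows "cosplit s \<delta> x \<psi> = sweedler s (\<delta> x) (\<lambda>x1 x2. sweedler s (\<delta> x2) (\<lambda>b c. \<psi> x1 b c))"
proof -
  have s: "vector_space s" using \<psi> by (simp add: trilinear_map_iff)
  have \<delta>: "comultiplication s \<delta>" using coalg by (simp add: cocomm_coassoc_coalgebra_def)
  have "\<exists>xs. \<delta> y = (\<Sum>(a, b)\<leftarrow>xs. a \<otimes>\<^bsub>s\<^esub> b)" for y
    using \<delta> s by (auto simp: comultiplication_def tensor_square_eq_sums)
  \<comment> \<open>With a list of pure tensors chosen for each \<open>\<delta> y\<close>, both iterated sums become sums over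
    lists of triples, to which the universal property of triple tensors applies.\<close>
  then obtain L where L: "\<delta> y = (\<Sum>(a, b)\<leftarrow>L y. a \<otimes>\<^bsub>s\<^esub> b)" for y by metis
  let ?l = "concat (map (\<lambda>(a, c). map (\<lambda>(p, q). (p, q, c)) (L a)) (L x))"
  let ?r = "concat (map (\<lambda>(a, c). map (\<lambda>(p, q). (a, p, q)) (L c)) (L x))"
  have nested:
      "(\<Sum>(p, q, r)\<leftarrow>concat (map (\<lambda>(a, c). map (\<lambda>(p, q). (p, q, c)) (L a)) zs). \<chi> p q r) =
        (\<Sum>(a, c)\<leftarrow>zs. \<Sum>(p, q)\<leftarrow>L a. \<chi> p q c)"
      "(\<Sum>(p, q, r)\<leftarrow>concat (map (\<lambda>(a, c). map (\<lambda>(p, q). (a, p, q)) (L c)) zs). \<chi> p q r) =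
        (\<Sum>(a, c)\<leftarrow>zs. \<Sum>(p, q)\<leftarrow>L c. \<chi> a p q)"
    for zs and \<chi> :: "'b \<Rightarrow> 'b \<Rightarrow> 'b \<Rightarrow> 'v::ab_group_add"
    by (induction zs) (auto simp: comp_def case_prod_unfold)
  have lr: "sweedler s (\<delta> x) (\<lambda>x1 x2. sweedler s (\<delta> x1) (\<lambda>p q. \<chi> p q x2)) = (\<Sum>(p, q, r)\<leftarrow>?l. \<chi> p q r)"
      "sweedler s (\<delta> x) (\<lambda>x1 x2. sweedler s (\<delta> x2) (\<lambda>p q. \<chi> x1 p q)) = (\<Sum>(p, q, r)\<leftarrow>?r. \<chi> p q r)"
    if \<chi>: "trilinear_map s sV \<chi>" for sV :: "'a \<Rightarrow> 'v::ab_group_add \<Rightarrow> 'v" and \<chi>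
  proof -
    have bil: "bilinear_map s sV (\<lambda>a b. \<chi> a b y)" "bilinear_map s sV (\<chi> y)" for y
      using \<chi> by (simp_all add: trilinear_map_iff bilinear_map_iff)
    note out = bilinear_map_cosplit[OF \<delta> \<chi>]
    have "sweedler s (\<delta> x) (\<lambda>x1 x2. sweedler s (\<delta> x1) (\<lambda>p q. \<chi> p q x2)) =
        (\<Sum>(a, c)\<leftarrow>L x. sweedler s (\<delta> a) (\<lambda>p q. \<chi> p q c))"
      by (subst L[of x]) (rule sweedler_sum_list[OF out(1)])
    also have "\<dots> = (\<Sum>(a, c)\<leftarrow>L x. \<Sum>(p, q)\<leftarrow>L a. \<chi> p q c)"
      by (simp only: L sweedler_sum_list[OF bil(1)])
    finally show "sweedler s (\<delta> x) (\<lambda>x1 x2. sweedler s (\<delta> x1) (\<lambda>p q. \<chi> p q x2)) =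
        (\<Sum>(p, q, r)\<leftarrow>?l. \<chi> p q r)" by (simp only: nested)
    have "sweedler s (\<delta> x) (\<lambda>x1 x2. sweedler s (\<delta> x2) (\<lambda>p q. \<chi> x1 p q)) =
        (\<Sum>(a, c)\<leftarrow>L x. sweedler s (\<delta> c) (\<lambda>p q. \<chi> a p q))"
      by (subst L[of x]) (rule sweedler_sum_list[OF out(2)])
    also have "\<dots> = (\<Sum>(a, c)\<leftarrow>L x. \<Sum>(p, q)\<leftarrow>L c. \<chi> a p q)"
      by (simp only: L sweedler_sum_list[OF bil(2)])
    finally show "sweedler s (\<delta> x) (\<lambda>x1 x2. sweedler s (\<delta> x2) (\<lambda>p q. \<chi> x1 p q)) =
        (\<Sum>(p, q, r)\<leftarrow>?r. \<chi> p q r)" by (simp only: nested)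
  qed
  have "(\<Sum>(p, q, r)\<leftarrow>?l. tensor3 s p q r) = (\<Sum>(p, q, r)\<leftarrow>?r. tensor3 s p q r)"
    using coalg unfolding lr[OF trilinear_map_tensor3[OF s], symmetric]
    by (simp add: cocomm_coassoc_coalgebra_def)
  from tensor3_relations_universal[OF \<psi> this] show ?thesis
    by (simp only: cosplit_def lr[OF \<psi>])
qed

text \<open>The swap of the first two legs is cocommutativity of the inner \<open>\<delta>\<close>. Coassociativity moves the
  inner \<open>\<delta>\<close> to the right, where cocommutativity swaps the last two.\<close>

lemma cosplit_swap:
  assumes coalg: "cocomm_coassoc_coalgebra s \<delta>" and \<psi>: "trilinear_map s sW \<psi>"
  shows cosplit_swap12: "cosplit s \<delta> x \<psi> = cosplit s \<delta> x (\<lambda>a b c. \<psi> b a c)"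
    and cosplit_swap23: "cosplit s \<delta> x \<psi> = cosplit s \<delta> x (\<lambda>a b c. \<psi> a c b)"
proof -
  have bil: "bilinear_map s sW (\<lambda>a b. \<psi> a b y)" "bilinear_map s sW (\<psi> y)" for y
    using \<psi> by (simp_all add: trilinear_map_iff bilinear_map_iff)
  have \<psi>': "trilinear_map s sW (\<lambda>a b c. \<psi> a c b)" using \<psi> by (simp add: trilinear_map_iff)
  show "cosplit s \<delta> x \<psi> = cosplit s \<delta> x (\<lambda>a b c. \<psi> b a c)"
    unfolding cosplit_def using sweedler_cocommutative[OF coalg bil(1)] by simp
  show "cosplit s \<delta> x \<psi> = cosplit s \<delta> x (\<lambda>a b c. \<psi> a c b)"
    unfolding cosplit_coassociative[OF coalg \<psi>] cosplit_coassociative[OF coalg \<psi>']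
    using sweedler_cocommutative[OF coalg bil(2)] by simp
qed

lemma cosplit_swap13:
  assumes coalg: "cocomm_coassoc_coalgebra s \<delta>" and \<psi>: "trilinear_map s sW \<psi>"
  shows "cosplit s \<delta> x \<psi> = cosplit s \<delta> x (\<lambda>a b c. \<psi> c b a)"
proof -
  have \<psi>': "trilinear_map s sW (\<lambda>a b c. \<psi> b a c)" "trilinear_map s sW (\<lambda>a b c. \<psi> c a b)"
    using \<psi> by (simp_all add: trilinear_map_iff)
  show ?thesis
    using cosplit_swap12[OF coalg \<psi>, of x] cosplit_swap23[OF coalg \<psi>'(1), of x]
      cosplit_swap12[OF coalg \<psi>'(2), of x] by simp
qed


section \<open>The induced bracket and cobracket\<close>

text \<open>The two sides of the Alia identity differ by the cyclic sum of \<open>[[x, y] - [y, x], z]\<close>, where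
  \<open>[x, y] - [y, x] = x \<cdot> f y - y \<cdot> f x\<close>. In it the terms \<open>x \<cdot> f y \<cdot> f z\<close> cancel in pairs, and
  so do the terms \<open>g (x \<cdot> f y \<cdot> z)\<close>.\<close>

lemma left_Alia_algebra_bracket_fg:
  assumes alg: "comm_assoc_algebra s m"
    and f: "Vector_Spaces.linear s s f" and g: "Vector_Spaces.linear s s g"
  shows "left_Alia_algebra s (bracket_fg m f g)"
proof -
  have s: "vector_space s" using f by (simp add: linear_map_iff)
  interpret vector_space s by fact
  note lin = f[unfolded linear_map_iff] g[unfolded linear_map_iff]
  have comm: "m x y = m y x" and assoc: "m (m x y) z = m x (m y z)" for x y z
    using alg by (auto simp: comm_assoc_algebra_def)
  have lcomm: "m y (m x z) = m x (m y z)" for x y z by (metis comm assoc)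
  have bil: "bilinear_map s s m" using alg by (simp add: comm_assoc_algebra_def)
  have "bilinear_map s s (bracket_fg m f g)"
    using bil lin by (simp add: bilinear_map_iff bracket_fg_def scale_right_distrib algebra_simps)
  then show ?thesis
    using bil lin
    by (simp add: left_Alia_algebra_def bracket_fg_def bilinear_map_iff assoc comm lcomm algebra_simps)
qed


lemma comultiplication_compose:
  assumes "comultiplication s \<delta>" "Vector_Spaces.linear s s G"
  shows "comultiplication s (\<lambda>x. \<delta> (G x))"
  using assms by (simp add: comultiplication_def linear_map_iff)

lemma sweedler_cobracket_FG:
  assumes \<delta>: "comultiplication s \<delta>" and F: "Vector_Spaces.linear s s F"
    and \<phi>: "bilinear_map s sW \<phi>"
  shows "sweedler s (cobracket_FG s \<delta> F G x) \<phi> =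
    sweedler s (\<delta> x) (\<lambda>a b. \<phi> a (F b)) + sweedler s (\<delta> (G x)) \<phi>"
proof -
  have sq: "\<delta> y \<in> tensor_square s" for y using \<delta> by (simp add: comultiplication_def)
  have bil: "bilinear_map s tensor_scale (\<lambda>a b. a \<otimes>\<^bsub>s\<^esub> F b)"
    using F bilinear_map_tensor[of s] by (simp add: linear_map_iff bilinear_map_iff)
  show ?thesis
    by (simp add: cobracket_FG_def sweedler_add[OF \<phi> sweedler_in_tensor_square[OF bil sq] sq]
        sweedler_sweedler[OF bil \<phi> sq])
qed

lemma comultiplication_cobracket_FG:
  assumes \<delta>: "comultiplication s \<delta>"
    and F: "Vector_Spaces.linear s s F" and G: "Vector_Spaces.linear s s G"
  shows "comultiplication s (cobracket_FG s \<delta> F G)"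
proof -
  have bil: "bilinear_map s tensor_scale (\<lambda>a b. a \<otimes>\<^bsub>s\<^esub> F b)"
    using F bilinear_map_tensor[of s] by (simp add: linear_map_iff bilinear_map_iff)
  have sq: "\<delta> y \<in> tensor_square s" for y using \<delta> by (simp add: comultiplication_def)
  have "Vector_Spaces.linear s tensor_scale (cobracket_FG s \<delta> F G)"
    using linear_sweedler_comultiplication[OF \<delta> bil] comultiplication_compose[OF \<delta> G]
    unfolding linear_map_iff comultiplication_def cobracket_FG_def
    by (simp add: vector_space.vector_space_assms(1) algebra_simps)
  then show ?thesis
    by (simp add: comultiplication_def cobracket_FG_def tensor_square_closed
        sweedler_in_tensor_square[OF bil] sq)
qed

text \<open>The summands are grouped by symmetry: with \<open>\<delta>\<close> fully symmetric, the first one is invariant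
  under exchange of the last two legs, the second one under exchange of the outer legs, and the
  bracketed rest under exchange of the first two legs, which come from a single \<open>\<delta> (G x\<^sub>1)\<close>.\<close>

lemma cosplit_cobracket_FG:
  assumes \<delta>: "comultiplication s \<delta>"
    and F: "Vector_Spaces.linear s s F" and G: "Vector_Spaces.linear s s G"
    and \<psi>: "trilinear_map s sW \<psi>"
  shows "cosplit s (cobracket_FG s \<delta> F G) x \<psi> =
    cosplit s \<delta> x (\<lambda>a b c. \<psi> a (F b) (F c)) +
    cosplit s \<delta> (G x) (\<lambda>a b c. \<psi> a (F b) c) +
    (sweedler s (\<delta> x) (\<lambda>x1 x2. sweedler s (\<delta> (G x1)) (\<lambda>a b. \<psi> a b (F x2))) +
     sweedler s (\<delta> (G x)) (\<lambda>x1 x2. sweedler s (\<delta> (G x1)) (\<lambda>a b. \<psi> a b x2)))"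
proof -
  have sq: "\<delta> y \<in> tensor_square s" for y using \<delta> by (simp add: comultiplication_def)
  have bil: "bilinear_map s sW (\<lambda>a b. \<psi> a b c)" for c
    using \<psi> by (simp add: trilinear_map_iff bilinear_map_iff)
  have \<psi>F: "trilinear_map s sW (\<lambda>a b c. \<psi> a (F b) (F c))" "trilinear_map s sW (\<lambda>a b c. \<psi> a (F b) c)"
      "trilinear_map s sW (\<lambda>a b c. \<psi> a b (F c))"
    using \<psi> F by (simp_all add: trilinear_map_iff linear_map_iff)
  note \<delta>G = comultiplication_compose[OF \<delta> G]
  note out = bilinear_map_cosplit(1)[OF comultiplication_cobracket_FG[OF \<delta> F G] \<psi>]
  note parts = bilinear_map_cosplit(1)[OF \<delta> \<psi>F(1)] bilinear_map_cosplit(1)[OF \<delta> \<psi>F(2)]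
    bilinear_map_cosplit(1)[OF \<delta>G \<psi>F(3)] bilinear_map_cosplit(1)[OF \<delta>G \<psi>]
  have "cosplit s (cobracket_FG s \<delta> F G) x \<psi> =
      sweedler s (\<delta> x) (\<lambda>x1 x2. sweedler s (\<delta> x1) (\<lambda>a b. \<psi> a (F b) (F x2)) +
        sweedler s (\<delta> (G x1)) (\<lambda>a b. \<psi> a b (F x2))) +
      sweedler s (\<delta> (G x)) (\<lambda>x1 x2. sweedler s (\<delta> x1) (\<lambda>a b. \<psi> a (F b) x2) +
        sweedler s (\<delta> (G x1)) (\<lambda>a b. \<psi> a b x2))"
    unfolding cosplit_def sweedler_cobracket_FG[OF \<delta> F out]
    by (simp only: sweedler_cobracket_FG[OF \<delta> F bil])
  then show ?thesis
    unfolding sweedler_plus[OF parts(1,3) sq] sweedler_plus[OF parts(2,4) sq]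
    by (simp add: cosplit_def)
qed

lemma left_Alia_coalgebra_cobracket_FG:
  assumes coalg: "cocomm_coassoc_coalgebra s \<delta>"
    and F: "Vector_Spaces.linear s s F" and G: "Vector_Spaces.linear s s G"
  shows "left_Alia_coalgebra s (cobracket_FG s \<delta> F G)"
proof -
  have \<delta>: "comultiplication s \<delta>" using coalg by (simp add: cocomm_coassoc_coalgebra_def)
  have s: "vector_space s" using F by (simp add: linear_map_iff)
  let ?U = "\<lambda>x \<psi>. cosplit s \<delta> x (\<lambda>a b c. \<psi> a (F b) (F c))"
  let ?V = "\<lambda>x \<psi>. cosplit s \<delta> (G x) (\<lambda>a b c. \<psi> a (F b) c)"
  let ?W = "\<lambda>x \<psi>. sweedler s (\<delta> x) (\<lambda>x1 x2. sweedler s (\<delta> (G x1)) (\<lambda>a b. \<psi> a b (F x2))) +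
     sweedler s (\<delta> (G x)) (\<lambda>x1 x2. sweedler s (\<delta> (G x1)) (\<lambda>a b. \<psi> a b x2))"
  let ?\<Delta> = "cobracket_FG s \<delta> F G"
  have t3: "trilinear_map s tensor_scale (\<lambda>a b c. tensor3 s b a c)"
      "trilinear_map s tensor_scale (\<lambda>a b c. tensor3 s a c b)"
      "trilinear_map s tensor_scale (\<lambda>a b c. tensor3 s c b a)"
      "trilinear_map s tensor_scale (\<lambda>a b c. tensor3 s a b c)"
      "trilinear_map s tensor_scale (\<lambda>a b c. tensor3 s b c a)"
      "trilinear_map s tensor_scale (\<lambda>a b c. tensor3 s c a b)"
    using trilinear_map_tensor3[OF s] by (simp_all add: trilinear_map_iff)
  have U: "?U x \<psi> = ?U x (\<lambda>a b c. \<psi> a c b)" and V: "?V x \<psi> = ?V x (\<lambda>a b c. \<psi> c b a)"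
    and W: "?W x \<psi> = ?W x (\<lambda>a b c. \<psi> b a c)"
    if \<psi>: "trilinear_map s tensor_scale \<psi>" for x and \<psi> :: "'b \<Rightarrow> 'b \<Rightarrow> 'b \<Rightarrow> ('b, 'a) tensor3"
  proof -
    have \<psi>F: "trilinear_map s tensor_scale (\<lambda>a b c. \<psi> a (F b) (F c))"
        "trilinear_map s tensor_scale (\<lambda>a b c. \<psi> a (F b) c)"
      using \<psi> F by (simp_all add: trilinear_map_iff linear_map_iff)
    show "?U x \<psi> = ?U x (\<lambda>a b c. \<psi> a c b)" by (rule cosplit_swap23[OF coalg \<psi>F(1)])
    show "?V x \<psi> = ?V x (\<lambda>a b c. \<psi> c b a)" by (rule cosplit_swap13[OF coalg \<psi>F(2)])
    have bil: "bilinear_map s tensor_scale (\<lambda>a b. \<psi> a b c)" for c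
      using \<psi> by (simp add: trilinear_map_iff bilinear_map_iff)
    have "sweedler s (\<delta> y) (\<lambda>a b. \<psi> a b c) = sweedler s (\<delta> y) (\<lambda>a b. \<psi> b a c)" for y c
      by (rule sweedler_cocommutative[OF coalg bil])
    then show "?W x \<psi> = ?W x (\<lambda>a b c. \<psi> b a c)" by simp
  qed
  have "cosplit s ?\<Delta> x (\<lambda>a b c. tensor3 s b a c) + cosplit s ?\<Delta> x (\<lambda>a b c. tensor3 s a c b) +
         cosplit s ?\<Delta> x (\<lambda>a b c. tensor3 s c b a) =
        cosplit s ?\<Delta> x (\<lambda>a b c. tensor3 s a b c) + cosplit s ?\<Delta> x (\<lambda>a b c. tensor3 s b c a) +
         cosplit s ?\<Delta> x (\<lambda>a b c. tensor3 s c a b)" for x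
  proof -
    note eqs = U[OF t3(1), of x] U[OF t3(2), of x] U[OF t3(3), of x]
      V[OF t3(1), of x] V[OF t3(2), of x] V[OF t3(3), of x]
      W[OF t3(1), of x] W[OF t3(2), of x] W[OF t3(3), of x]
    \<comment> \<open>The three terms on the left are the odd permutations. The transposition that fixes a part
      sends them to the three even ones, in an order that depends on the part.\<close>
    have reg: "(u1 + v1 + w1) + (u2 + v2 + w2) + (u3 + v3 + w3) =
        (u2 + v3 + w1) + (u3 + v1 + w2) + (u1 + v2 + w3)"
      for u1 u2 u3 v1 v2 v3 w1 w2 w3 :: "('b, 'a) tensor3"
      by (simp add: ac_simps)
    show ?thesis
      unfolding t3[THEN cosplit_cobracket_FG[OF \<delta> F G]] eqs by (rule reg)
  qed
  then show ?thesis
    unfolding left_Alia_coalgebra_def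
    using comultiplication_cobracket_FG[OF \<delta> F G] by blast
qed

section \<open>Compatibility of the bracket and the cobracket\<close>

lemma flip_minus_id_add_diff:
  assumes "vector_space s" "t \<in> tensor_square s" "u \<in> tensor_square s"
  shows "flip_minus_id s (t + u) = flip_minus_id s t + flip_minus_id s u"
    and "flip_minus_id s (t - u) = flip_minus_id s t - flip_minus_id s u"
proof -
  have bil: "bilinear_map s tensor_scale (\<lambda>a b. b \<otimes>\<^bsub>s\<^esub> a)"
    using bilinear_map_tensor[OF assms(1)] by (simp add: bilinear_map_iff)
  show "flip_minus_id s (t + u) = flip_minus_id s t + flip_minus_id s u"
      "flip_minus_id s (t - u) = flip_minus_id s t - flip_minus_id s u"
    by (simp_all add: flip_minus_id_def flip_def sweedler_add[OF bil assms(2,3)]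
        sweedler_diff[OF bil assms(2,3)])
qed

lemma flip_minus_id_sweedler:
  assumes \<chi>: "bilinear_map s tensor_scale (\<lambda>a b. p a b \<otimes>\<^bsub>s\<^esub> q a b)" and t: "t \<in> tensor_square s"
  shows "flip_minus_id s (sweedler s t (\<lambda>a b. p a b \<otimes>\<^bsub>s\<^esub> q a b)) =
    sweedler s t (\<lambda>a b. q a b \<otimes>\<^bsub>s\<^esub> p a b) - sweedler s t (\<lambda>a b. p a b \<otimes>\<^bsub>s\<^esub> q a b)"
proof -
  have "bilinear_map s tensor_scale (\<lambda>a b. b \<otimes>\<^bsub>s\<^esub> a)"
    using bilinear_map_tensor[of s] \<chi> by (simp add: bilinear_map_iff)
  then show ?thesis
    by (simp add: flip_minus_id_def flip_def sweedler_sweedler[OF \<chi> _ t])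
qed

theorem theorem4p2:
  fixes s :: "'k::field_char_0 \<Rightarrow> 'a::ab_group_add \<Rightarrow> 'a" (structure)
    and mult :: "'a \<Rightarrow> 'a \<Rightarrow> 'a" (infixl "\<cdot>" 75)
    and \<delta> :: "'a \<Rightarrow> ('a, 'k) tensor2"
    and f g F G :: "'a \<Rightarrow> 'a"
  assumes "vector_space s"
    and "comm_cocomm_assoc_D_bialgebra s (\<cdot>) \<delta>"
    and "Vector_Spaces.linear s s f" and "Vector_Spaces.linear s s g"
    and "Vector_Spaces.linear s s F" and "Vector_Spaces.linear s s G"
  shows "left_Alia_bialgebra s (bracket_fg (\<cdot>) f g) (cobracket_FG s \<delta> F G) \<longleftrightarrow>
    (\<forall>x y.
        sweedler s (\<delta> (f y)) (\<lambda>a b. a \<otimes> F (x \<cdot> b))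
      - sweedler s (\<delta> (f y)) (\<lambda>a b. F (x \<cdot> b) \<otimes> a)
      + sweedler s (\<delta> x) (\<lambda>a b. F b \<otimes> g (a \<cdot> y))
      - sweedler s (\<delta> x) (\<lambda>a b. g (a \<cdot> y) \<otimes> F b)
      + sweedler s (\<delta> (G x)) (\<lambda>a b. b \<otimes> (a \<cdot> f y))
      - sweedler s (\<delta> (G x)) (\<lambda>a b. (a \<cdot> f y) \<otimes> b)
      + sweedler s (\<delta> (G x)) (\<lambda>a b. b \<otimes> g (a \<cdot> y))
      - sweedler s (\<delta> (G x)) (\<lambda>a b. g (a \<cdot> y) \<otimes> b)
      + sweedler s (\<delta> (f x)) (\<lambda>a b. F (y \<cdot> b) \<otimes> a)
      - sweedler s (\<delta> (f x)) (\<lambda>a b. a \<otimes> F (y \<cdot> b))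
      - sweedler s (\<delta> y) (\<lambda>a b. F b \<otimes> g (a \<cdot> x))
      + sweedler s (\<delta> y) (\<lambda>a b. g (a \<cdot> x) \<otimes> F b)
      - sweedler s (\<delta> (G y)) (\<lambda>a b. b \<otimes> (a \<cdot> f x))
      + sweedler s (\<delta> (G y)) (\<lambda>a b. (a \<cdot> f x) \<otimes> b)
      - sweedler s (\<delta> (G y)) (\<lambda>a b. b \<otimes> g (a \<cdot> x))
      + sweedler s (\<delta> (G y)) (\<lambda>a b. g (a \<cdot> x) \<otimes> b)
      = 0)"
proof -
  let ?\<Delta> = "cobracket_FG s \<delta> F G" and ?N = "flip_minus_id s"
  note s = assms(1) and f = assms(3) and g = assms(4) and F = assms(5) and G = assms(6)
  have alg: "comm_assoc_algebra s (\<cdot>)" and coalg: "cocomm_coassoc_coalgebra s \<delta>"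
    and D: "\<delta> (a \<cdot> b) = sweedler s (\<delta> a) (\<lambda>a1 a2. (a1 \<cdot> b) \<otimes> a2) +
      sweedler s (\<delta> b) (\<lambda>b1 b2. b1 \<otimes> (a \<cdot> b2))" for a b
    using assms(2) by (simp_all add: comm_cocomm_assoc_D_bialgebra_def)
  have comm: "a \<cdot> b = b \<cdot> a" for a b using alg by (simp add: comm_assoc_algebra_def)
  have \<delta>: "comultiplication s \<delta>" using coalg by (simp add: cocomm_coassoc_coalgebra_def)
  have sq: "\<delta> x \<in> tensor_square s" for x using \<delta> by (simp add: comultiplication_def)
  have \<Delta>: "comultiplication s ?\<Delta>" by (rule comultiplication_cobracket_FG[OF \<delta> F G])
  have sq\<Delta>: "?\<Delta> x \<in> tensor_square s" for x using \<Delta> by (simp add: comultiplication_def)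

  have bil: "bilinear_map s tensor_scale (\<lambda>a b. a \<otimes> b)"
      "bilinear_map s tensor_scale (\<lambda>a b. a \<otimes> F b)"
      "bilinear_map s tensor_scale (\<lambda>a b. (a \<cdot> y) \<otimes> b)"
      "bilinear_map s tensor_scale (\<lambda>a b. (a \<cdot> y) \<otimes> F b)"
      "bilinear_map s tensor_scale (\<lambda>a b. a \<otimes> (y \<cdot> b))"
      "bilinear_map s tensor_scale (\<lambda>a b. a \<otimes> F (y \<cdot> b))"
      "bilinear_map s tensor_scale (\<lambda>a b. g (a \<cdot> y) \<otimes> b)"
      "bilinear_map s tensor_scale (\<lambda>a b. g (a \<cdot> y) \<otimes> F b)"
      "bilinear_map s tensor_scale (\<lambda>a b. bracket_fg (\<cdot>) f g a y \<otimes> b)" for y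
  proof -
    have mult: "Vector_Spaces.linear s s (\<lambda>a. a \<cdot> y)" "Vector_Spaces.linear s s (\<lambda>a. y \<cdot> a)"
      using alg by (simp_all add: comm_assoc_algebra_def bilinear_map_def)
    have id: "Vector_Spaces.linear s s (\<lambda>a. a)" using s by (simp add: linear_map_iff)
    have comp: "Vector_Spaces.linear s s (\<lambda>a. g (a \<cdot> y))" "Vector_Spaces.linear s s (\<lambda>a. F (y \<cdot> a))"
      using mult g F by (simp_all add: linear_map_iff)
    have br: "Vector_Spaces.linear s s (\<lambda>a. bracket_fg (\<cdot>) f g a y)"
      using left_Alia_algebra_bracket_fg[OF alg f g] by (simp add: left_Alia_algebra_def bilinear_map_def)
    show "bilinear_map s tensor_scale (\<lambda>a b. a \<otimes> b)"
      "bilinear_map s tensor_scale (\<lambda>a b. a \<otimes> F b)"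
      "bilinear_map s tensor_scale (\<lambda>a b. (a \<cdot> y) \<otimes> b)"
      "bilinear_map s tensor_scale (\<lambda>a b. (a \<cdot> y) \<otimes> F b)"
      "bilinear_map s tensor_scale (\<lambda>a b. a \<otimes> (y \<cdot> b))"
      "bilinear_map s tensor_scale (\<lambda>a b. a \<otimes> F (y \<cdot> b))"
      "bilinear_map s tensor_scale (\<lambda>a b. g (a \<cdot> y) \<otimes> b)"
      "bilinear_map s tensor_scale (\<lambda>a b. g (a \<cdot> y) \<otimes> F b)"
      "bilinear_map s tensor_scale (\<lambda>a b. bracket_fg (\<cdot>) f g a y \<otimes> b)"
      by (rule bilinear_map_tensor_compose id F mult comp br)+
  qed
  note mem = sweedler_in_tensor_square[OF _ sq]

  \<comment> \<open>By cocommutativity \<open>\<tau> - id\<close> kills the summand \<open>\<delta> (G z)\<close> of \<open>\<Delta> z\<close>; the D-bialgebra identity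
    expands what is left.\<close>
  have N\<delta>: "?N (\<delta> z) = 0" for z
    using coalg by (simp add: flip_minus_id_def cocomm_coassoc_coalgebra_def)
  have N\<Delta>: "?N (?\<Delta> (x \<cdot> f y)) =
      ?N (sweedler s (\<delta> x) (\<lambda>a b. (a \<cdot> f y) \<otimes> F b)) +
      ?N (sweedler s (\<delta> (f y)) (\<lambda>a b. a \<otimes> F (x \<cdot> b)))" for x y
  proof -
    have "sweedler s (\<delta> (x \<cdot> f y)) (\<lambda>a b. a \<otimes> F b) =
        sweedler s (\<delta> x) (\<lambda>a b. (a \<cdot> f y) \<otimes> F b) + sweedler s (\<delta> (f y)) (\<lambda>a b. a \<otimes> F (x \<cdot> b))"
      unfolding D sweedler_add[OF bil(2) mem[OF bil(3)] mem[OF bil(5)]]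
        sweedler_sweedler[OF bil(3) bil(2) sq] sweedler_sweedler[OF bil(5) bil(2) sq] ..
    then show ?thesis
      unfolding cobracket_FG_def
      by (simp add: flip_minus_id_add_diff[OF s] tensor_square_closed mem bil sq N\<delta>)
  qed
  \<comment> \<open>The \<open>g\<close>-part of the bracket is symmetric, so the commutator does not see it.\<close>
  have lhs: "?N (?\<Delta> (bracket_fg (\<cdot>) f g x y - bracket_fg (\<cdot>) f g y x)) =
      ?N (?\<Delta> (x \<cdot> f y)) - ?N (?\<Delta> (y \<cdot> f x))" for x y
  proof -
    have "bracket_fg (\<cdot>) f g x y - bracket_fg (\<cdot>) f g y x = x \<cdot> f y - y \<cdot> f x"
      by (simp add: bracket_fg_def comm[of y x])
    moreover have "?\<Delta> (x \<cdot> f y - y \<cdot> f x) = ?\<Delta> (x \<cdot> f y) - ?\<Delta> (y \<cdot> f x)"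
    proof -
      have "?\<Delta> (u + v) = ?\<Delta> u + ?\<Delta> v" for u v
        using \<Delta> by (simp add: comultiplication_def linear_map_iff)
      from this[of "x \<cdot> f y - y \<cdot> f x" "y \<cdot> f x"] show ?thesis by (simp add: algebra_simps)
    qed
    ultimately show ?thesis by (simp add: flip_minus_id_add_diff[OF s sq\<Delta> sq\<Delta>])
  qed
  have rhs_mem: "map_tensor s (\<lambda>z. bracket_fg (\<cdot>) f g z y) id (?\<Delta> x) \<in> tensor_square s" for x y
    unfolding map_tensor_def id_apply by (rule sweedler_in_tensor_square[OF bil(9) sq\<Delta>])
  \<comment> \<open>The first summand is also the first summand of \<open>N\<Delta>\<close>, so it drops out of the
    compatibility condition; the other three give twelve of the sixteen terms.\<close>
  have rhs: "?N (map_tensor s (\<lambda>z. bracket_fg (\<cdot>) f g z y) id (?\<Delta> x)) =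
      ?N (sweedler s (\<delta> x) (\<lambda>a b. (a \<cdot> f y) \<otimes> F b)) +
      ?N (sweedler s (\<delta> x) (\<lambda>a b. g (a \<cdot> y) \<otimes> F b)) +
      ?N (sweedler s (\<delta> (G x)) (\<lambda>a b. (a \<cdot> f y) \<otimes> b)) +
      ?N (sweedler s (\<delta> (G x)) (\<lambda>a b. g (a \<cdot> y) \<otimes> b))" for x y
  proof -
    have split: "bracket_fg (\<cdot>) f g a y \<otimes> b = ((a \<cdot> f y) \<otimes> b) + (g (a \<cdot> y) \<otimes> b)" for a b
      using bilinear_map_tensor[OF s] by (simp add: bilinear_map_iff bracket_fg_def)
    have "map_tensor s (\<lambda>z. bracket_fg (\<cdot>) f g z y) id (?\<Delta> x) =
        (sweedler s (\<delta> x) (\<lambda>a b. (a \<cdot> f y) \<otimes> F b) + sweedler s (\<delta> x) (\<lambda>a b. g (a \<cdot> y) \<otimes> F b)) +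
        (sweedler s (\<delta> (G x)) (\<lambda>a b. (a \<cdot> f y) \<otimes> b) + sweedler s (\<delta> (G x)) (\<lambda>a b. g (a \<cdot> y) \<otimes> b))"
      unfolding map_tensor_def id_apply sweedler_cobracket_FG[OF \<delta> F bil(9)]
      unfolding split sweedler_plus[OF bil(4) bil(8) sq] sweedler_plus[OF bil(3) bil(7) sq] ..
    then show ?thesis
      by (simp add: flip_minus_id_add_diff[OF s] tensor_square_closed mem bil add.assoc)
  qed
  note N = flip_minus_id_sweedler[OF _ sq]
  \<comment> \<open>The signs of the sixteen terms are those of the right-hand side minus the left-hand side.\<close>
  have group: "p = q \<longleftrightarrow> e = 0" if "q - p = e" for p q e :: "('a, 'k) tensor2"
    using that by auto
  have compat: "left_Alia_bialgebra s (bracket_fg (\<cdot>) f g) ?\<Delta> \<longleftrightarrow>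
    (\<forall>x y. ?N (?\<Delta> (bracket_fg (\<cdot>) f g x y - bracket_fg (\<cdot>) f g y x)) =
      ?N (map_tensor s (\<lambda>z. bracket_fg (\<cdot>) f g z y) id (?\<Delta> x) -
          map_tensor s (\<lambda>z. bracket_fg (\<cdot>) f g z x) id (?\<Delta> y)))"
    using left_Alia_algebra_bracket_fg[OF alg f g] left_Alia_coalgebra_cobracket_FG[OF coalg F G]
    by (simp add: left_Alia_bialgebra_def)
  show ?thesis
    unfolding compat
    by (intro arg_cong[where f = All] ext group)
      (simp add: lhs N\<Delta> flip_minus_id_add_diff[OF s rhs_mem rhs_mem] rhs N bil algebra_simps)
qed

end
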